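(* Let $n, d, T \ge 1$ be integers, let $\mathbf{x} = (x_1,\ldots,x_n)$, and let $P = \sum_{i=1}^{T} \ell_i^d \in \mathbb{C}[\mathbf{x}]$ be a homogeneous polynomial of degree $d$, where each $\ell_i \in \mathbb{C}[\mathbf{x}]$ is a homogeneous linear form. Then there exists a depth-$3$ ($\sum\prod\sum$) circuit $C$ over $\mathbb{C}(\varepsilon)$ in the variables $\mathbf{x}$, with top fan-in at most $d+1$ and formal degree at most $d\cdot T$, such that the polynomial computed by $C$ satisfies $$C \equiv P + \varepsilon\, Q,$$ where $Q \in \mathbb{C}[\varepsilon,\mathbf{x}]$ and every monomial (in $\mathbf{x}$) with a non-zero coefficient in $Q$ has degree (in $\mathbf{x}$) strictly greater than $d$.
   Context: $\varepsilon$ is a formal variable independent of $\mathbf{x}$, and $\mathbb{C}(\varepsilon)$ is the field of rational functions in $\varepsilon$. A depth-$3$ ($\sum\prod\sum$) circuit over a field $\mathbb{F}$ in variables $\mathbf{x}$ is an expression $\sum_{i=1}^{k}\prod_{j=1}^{D_i} L_{i,j}$, where each $L_{i,j}$ is an affine form in $\mathbf{x}$, i.e. a polynomial of degree at most $1$ in $\mathbf{x}$ with coefficients in $\mathbb{F}$ (scalar multiples of products can be absorbed into affine forms). Its top fan-in is $k$ and its formal degree is $\max_i D_i$. The symbol $\equiv$ denotes equality of polynomials in $\mathbf{x}$ over $\mathbb{C}(\varepsilon)$. *)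

theory Defs
  imports
    Complex_Main
    "HOL-Library.Poly_Mapping"
    "HOL-Computational_Algebra.Polynomial_Factorial"
begin

text \<open>
  Polynomials in the variables \<open>x\<^sub>1, x\<^sub>2, \<dots>\<close>: a monomial is its finitely supported exponent
  vector, a polynomial a finitely supported family of coefficients.  The ring structure
  (convolution product) is the one of \<^theory>\<open>HOL-Library.Poly_Mapping\<close>.
\<close>

type_synonym 'a mpoly = "(nat \<Rightarrow>\<^sub>0 nat) \<Rightarrow>\<^sub>0 'a"

definition mon_degree :: "(nat \<Rightarrow>\<^sub>0 nat) \<Rightarrow> nat" where
  "mon_degree m = (\<Sum>i\<in>Poly_Mapping.keys m. Poly_Mapping.lookup m i)"

definition polys_in :: "nat \<Rightarrow> 'a::zero mpoly set" where
  "polys_in n = {p. \<forall>m\<in>Poly_Mapping.keys p. Poly_Mapping.keys m \<subseteq> {1..n}}"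

text \<open>As usual, the zero polynomial is homogeneous of every degree.\<close>

definition homogeneous :: "nat \<Rightarrow> 'a::zero mpoly \<Rightarrow> bool" where
  "homogeneous d p \<longleftrightarrow> (\<forall>m\<in>Poly_Mapping.keys p. mon_degree m = d)"

definition linear_form :: "nat \<Rightarrow> 'a::zero mpoly \<Rightarrow> bool" where
  "linear_form n p \<longleftrightarrow> p \<in> polys_in n \<and> homogeneous 1 p"

definition affine_form :: "nat \<Rightarrow> 'a::zero mpoly \<Rightarrow> bool" where
  "affine_form n p \<longleftrightarrow> p \<in> polys_in n \<and> (\<forall>m\<in>Poly_Mapping.keys p. mon_degree m \<le> 1)"

text \<open>
  A depth-3 circuit is given by the list of its product gates, each gate being the list of
  the affine forms it multiplies.
\<close>

type_synonym 'a circuit3 = "'a mpoly list list"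

definition depth3_circuit :: "nat \<Rightarrow> 'a::zero circuit3 \<Rightarrow> bool" where
  "depth3_circuit n C \<longleftrightarrow> (\<forall>g\<in>set C. \<forall>L\<in>set g. affine_form n L)"

definition computed_poly :: "'a::comm_semiring_1 circuit3 \<Rightarrow> 'a mpoly" where
  "computed_poly C = sum_list (map prod_list C)"

definition top_fanin :: "'a circuit3 \<Rightarrow> nat" where
  "top_fanin C = length C"

text \<open>The inserted \<open>0\<close> only matters for the circuit without product gates.\<close>

definition formal_degree :: "'a circuit3 \<Rightarrow> nat" where
  "formal_degree C = Max (insert 0 (length ` set C))"

text \<open>
  \<open>\<complex>[\<epsilon>]\<close> is \<^typ>\<open>complex poly\<close>, and \<open>\<complex>(\<epsilon>)\<close> is its fraction field.  Accordingly \<open>\<complex>[\<epsilon>,x]\<close> is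
  represented as \<open>\<complex>[\<epsilon>][x]\<close>.
\<close>

type_synonym ratfun = "complex poly fract"

definition eps :: ratfun where
  "eps = to_fract [:0, 1:]"

definition mconst :: "'a::zero \<Rightarrow> 'a mpoly" where
  "mconst c = Poly_Mapping.single 0 c"

text \<open>The inclusions of \<open>\<complex>[x]\<close> and of \<open>\<complex>[\<epsilon>,x]\<close> into \<open>\<complex>(\<epsilon>)[x]\<close>.\<close>

definition embed_C :: "complex mpoly \<Rightarrow> ratfun mpoly" where
  "embed_C p = Poly_Mapping.map (\<lambda>c. to_fract [:c:]) p"

definition embed_Ceps :: "complex poly mpoly \<Rightarrow> ratfun mpoly" where
  "embed_Ceps q = Poly_Mapping.map to_fract q"

end

theory Submission
  imports
    Defs
    "HOL-Computational_Algebra.Fundamental_Theorem_Algebra"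
begin

text \<open>
  Two product gates suffice.  Expanding the product \<open>\<Prod>\<^sub>i (1 + (\<epsilon> \<ell>\<^sub>i)\<^sup>d)\<close> gives
  \<open>1 + \<epsilon>\<^sup>d P + \<epsilon>\<^sup>2\<^sup>d R\<close>, where every monomial of \<open>R\<close> has degree at least \<open>2 d\<close>; hence
  \<open>\<epsilon>\<^sup>-\<^sup>d \<Prod>\<^sub>i (1 + (\<epsilon> \<ell>\<^sub>i)\<^sup>d) - \<epsilon>\<^sup>-\<^sup>d = P + \<epsilon>\<^sup>d R\<close>.  Over the complex numbers \<open>1 + y\<^sup>d\<close> is a
  product of \<open>d\<close> affine factors in \<open>y\<close>, so the first summand is a product of \<open>d T\<close> affine forms,
  and the second one is a constant gate.
\<close>

subsection \<open>Coefficientwise maps\<close>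

lemma lookup_map_zero:
  assumes "f 0 = 0"
  shows "Poly_Mapping.lookup (Poly_Mapping.map f p) k = f (Poly_Mapping.lookup p k)"
  by (simp add: map.rep_eq when_def assms)

lemma map_zero [simp]: "Poly_Mapping.map f 0 = 0"
  by (rule poly_mapping_eqI) (simp add: map.rep_eq)

lemma keys_map_subset: "Poly_Mapping.keys (Poly_Mapping.map f p) \<subseteq> Poly_Mapping.keys p"
  by (auto simp: in_keys_iff map.rep_eq)

lemma map_add:
  assumes "f 0 = 0" and "\<And>x y. f (x + y) = f x + f y"
  shows "Poly_Mapping.map f (p + q) = Poly_Mapping.map f p + Poly_Mapping.map f q"
  by (rule poly_mapping_eqI) (simp add: lookup_map_zero assms lookup_add)

text \<open>Updating a key outside the support is the same as adding a \<open>single\<close>. This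
  reduces identities that are additive in \<open>p\<close> to the case of one term.\<close>

lemma poly_mapping_add_induct [case_names zero single add]:
  fixes p :: "'a \<Rightarrow>\<^sub>0 'b::comm_monoid_add"
  assumes "P 0" and "\<And>a x. P (Poly_Mapping.single a x)"
    and "\<And>p q. P p \<Longrightarrow> P q \<Longrightarrow> P (p + q)"
  shows "P p"
proof (induction p rule: update_induct)
  case const
  show ?case by fact
next
  case (update f a b)
  have "Poly_Mapping.update a b f = Poly_Mapping.single a b + f"
    using update(1)
    by (intro poly_mapping_eqI)
       (auto simp: lookup_update lookup_add lookup_single when_def in_keys_iff)
  then show ?case using assms update by simp
qed

text \<open>Both sides are additive in \<open>p\<close> and in \<open>q\<close>, so two nested
  inductions leave a product of two terms, where multiplicativity of \<open>f\<close> on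
  coefficients decides.\<close>

lemma map_mult:
  fixes f :: "'b::comm_semiring_0 \<Rightarrow> 'c::comm_semiring_0"
    and p q :: "'a::comm_monoid_add \<Rightarrow>\<^sub>0 'b"
  assumes "f 0 = 0" and "\<And>x y. f (x + y) = f x + f y" and "\<And>x y. f (x * y) = f x * f y"
  shows "Poly_Mapping.map f (p * q) = Poly_Mapping.map f p * Poly_Mapping.map f q"
proof (induction p rule: poly_mapping_add_induct)
  case zero
  show ?case by simp
next
  case (single a x)
  show ?case
    by (induction q rule: poly_mapping_add_induct)
       (simp_all add: map_add assms mult_single map_single distrib_left)
next
  case (add p1 p2)
  then show ?case by (simp add: map_add assms distrib_right)
qed

section \<open>The inclusions into polynomials over \<open>ratfun\<close> as ring
  homomorphisms\<close>

lemma embed_Ceps_add: "embed_Ceps (p + q) = embed_Ceps p + embed_Ceps q"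
  by (simp add: embed_Ceps_def map_add)

lemma embed_Ceps_mult: "embed_Ceps (p * q) = embed_Ceps p * embed_Ceps q"
  by (simp add: embed_Ceps_def map_mult)

lemma embed_Ceps_mconst: "embed_Ceps (mconst c) = mconst (to_fract c)"
  by (simp add: embed_Ceps_def mconst_def map_single)

lemma embed_Ceps_one: "embed_Ceps 1 = 1"
  using embed_Ceps_mconst[of 1] by (simp add: mconst_def)

lemma embed_Ceps_power: "embed_Ceps (p ^ k) = embed_Ceps p ^ k"
  by (induction k) (simp_all add: embed_Ceps_one embed_Ceps_mult)

lemma embed_Ceps_sum: "embed_Ceps (\<Sum>i\<in>A. f i) = (\<Sum>i\<in>A. embed_Ceps (f i))"
  by (induction A rule: infinite_finite_induct)
     (simp_all add: embed_Ceps_add, simp_all add: embed_Ceps_def)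

lemma embed_Ceps_prod: "embed_Ceps (\<Prod>i\<in>A. f i) = (\<Prod>i\<in>A. embed_Ceps (f i))"
  by (induction A rule: infinite_finite_induct) (simp_all add: embed_Ceps_one embed_Ceps_mult)

lemma embed_C_add: "embed_C (p + q) = embed_C p + embed_C q"
  by (simp add: embed_C_def map_add flip: to_fract_add)

lemma embed_C_mult: "embed_C (p * q) = embed_C p * embed_C q"
  by (simp add: embed_C_def map_add map_mult flip: to_fract_add to_fract_mult)

text \<open>Factoring the inclusion through polynomials over \<open>complex poly\<close> lets the
  product be expanded there, so that the remainder keeps coefficients polynomial in
  \<open>eps\<close>.\<close>

lemma embed_C_conv_embed_Ceps: "embed_C p = embed_Ceps (Poly_Mapping.map (\<lambda>c. [:c:]) p)"
  by (rule poly_mapping_eqI) (simp add: embed_C_def embed_Ceps_def lookup_map_zero)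

lemma embed_C_power: "embed_C (p ^ k) = embed_C p ^ k"
proof (induction k)
  case 0
  show ?case
    by (simp add: embed_C_def map_single one_pCons[symmetric] flip: single_one)
qed (simp add: embed_C_mult)

lemma embed_C_sum: "embed_C (\<Sum>i\<in>A. f i) = (\<Sum>i\<in>A. embed_C (f i))"
  by (induction A rule: infinite_finite_induct)
     (simp_all add: embed_C_add, simp_all add: embed_C_def)

lemma mconst_mult: "mconst (a * b) = mconst a * mconst b"
  by (simp add: mconst_def mult_single)

lemma mconst_one [simp]: "mconst 1 = 1"
  by (simp add: mconst_def)

lemma mconst_power: "mconst (a ^ k) = mconst a ^ k"
  by (induction k) (simp_all add: mconst_mult)

subsection \<open>Degrees of monomials\<close>

lemma mon_degree_add: "mon_degree (a + b) = mon_degree a + mon_degree b"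
  unfolding mon_degree_def
  using setsum_keys_plus_distrib[of "\<lambda>_ x. x" a b] by simp

lemma keys_mconst_mult: "Poly_Mapping.keys (mconst c * p) \<subseteq> Poly_Mapping.keys p"
  using keys_mult[of "mconst c" p] by (auto simp: mconst_def split: if_splits)

text \<open>Over a commutative ring this is the \<open>k\<close>-th power of the ideal generated by
  the variables, inside the polynomials in \<open>n\<close> variables. Both requirements on
  \<open>Q\<close>, its variables and its lowest degree, are tracked at once.\<close>

definition polys_order_ge :: "nat \<Rightarrow> nat \<Rightarrow> 'a::zero mpoly set" where
  "polys_order_ge n k =
     {p. \<forall>m\<in>Poly_Mapping.keys p. Poly_Mapping.keys m \<subseteq> {1..n} \<and> k \<le> mon_degree m}"

lemma polys_order_ge_zero: "0 \<in> polys_order_ge n k"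
  by (simp add: polys_order_ge_def)

lemma polys_order_ge_add:
  "p \<in> polys_order_ge n k \<Longrightarrow> q \<in> polys_order_ge n k \<Longrightarrow> p + q \<in> polys_order_ge n k"
  using keys_add[of p q] by (auto simp: polys_order_ge_def)

lemma polys_order_ge_mult:
  assumes "p \<in> polys_order_ge n j" and "q \<in> polys_order_ge n k"
  shows "p * q \<in> polys_order_ge n (j + k)"
  unfolding polys_order_ge_def
proof (safe del: subsetI)
  fix m assume "m \<in> Poly_Mapping.keys (p * q)"
  then obtain a b where m: "m = a + b" "a \<in> Poly_Mapping.keys p" "b \<in> Poly_Mapping.keys q"
    using keys_mult[of p q] by auto
  with assms have "Poly_Mapping.keys a \<subseteq> {1..n}" "j \<le> mon_degree a"
    and "Poly_Mapping.keys b \<subseteq> {1..n}" "k \<le> mon_degree b"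
    by (auto simp: polys_order_ge_def)
  then show "Poly_Mapping.keys m \<subseteq> {1..n}" and "j + k \<le> mon_degree m"
    using keys_add[of a b] by (auto simp: m mon_degree_add)
qed

lemma polys_order_ge_mconst_mult:
  "p \<in> polys_order_ge n k \<Longrightarrow> mconst c * p \<in> polys_order_ge n k"
  using keys_mconst_mult[of c p] by (auto simp: polys_order_ge_def)

lemma polys_order_ge_power:
  "p \<in> polys_order_ge n j \<Longrightarrow> p ^ k \<in> polys_order_ge n (j * k)"
proof (induction k)
  case 0
  show ?case by (simp add: polys_order_ge_def)
next
  case (Suc k)
  then show ?case using polys_order_ge_mult[of p n j "p ^ k" "j * k"] by simp
qed

lemma polys_order_ge_sum:
  "(\<And>i. i \<in> A \<Longrightarrow> f i \<in> polys_order_ge n k) \<Longrightarrow> (\<Sum>i\<in>A. f i) \<in> polys_order_ge n k"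
  by (induction A rule: infinite_finite_induct)
     (simp_all add: polys_order_ge_zero polys_order_ge_add)

lemma polys_order_ge_mono:
  "p \<in> polys_order_ge n k \<Longrightarrow> j \<le> k \<Longrightarrow> p \<in> polys_order_ge n j"
  by (auto simp: polys_order_ge_def)

text \<open>Induction on \<open>T\<close>: multiplying by one more factor creates only cross terms
  of order at least \<open>2 * d\<close> beyond the sum of powers. The coefficient ring is left
  general so that \<open>c\<close> can be the variable of \<open>complex poly\<close>, which yields
  \<open>R\<close> without denominators.\<close>

lemma prod_one_plus_power_expansion:
  fixes f :: "nat \<Rightarrow> 'a::comm_ring_1 mpoly"
  assumes "\<And>i. i \<in> {1..T} \<Longrightarrow> f i \<in> polys_order_ge n 1"
  shows "\<exists>R \<in> polys_order_ge n (2 * d).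
    (\<Prod>i=1..T. 1 + (mconst c * f i) ^ d) =
      1 + mconst c ^ d * (\<Sum>i=1..T. f i ^ d) + mconst c ^ (2 * d) * R"
  using assms
proof (induction T)
  case 0
  show ?case by (auto intro!: bexI[of _ 0] simp: polys_order_ge_zero)
next
  case (Suc T)
  define S where "S = (\<Sum>i=1..T. f i ^ d)"
  define g where "g = f (Suc T) ^ d"
  define E where "E = (mconst c :: 'a mpoly)"
  obtain R where R: "R \<in> polys_order_ge n (2 * d)"
    and eq: "(\<Prod>i=1..T. 1 + (E * f i) ^ d) = 1 + E ^ d * S + E ^ (2 * d) * R"
    unfolding E_def S_def using Suc.IH Suc.prems by auto
  have ord: "f i ^ d \<in> polys_order_ge n d" if "i \<in> {1..Suc T}" for i
    using polys_order_ge_power[OF Suc.prems[OF that], of d] by simp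
  have S: "S \<in> polys_order_ge n d"
    unfolding S_def by (rule polys_order_ge_sum) (use ord in auto)
  have g: "g \<in> polys_order_ge n d"
    unfolding g_def by (rule ord) simp
  have Rg: "R * g \<in> polys_order_ge n (2 * d)"
    by (rule polys_order_ge_mono[OF polys_order_ge_mult[OF R g]]) simp
  \<comment> \<open>The terms of \<open>(1 + E^d * S + E^(2*d) * R) * (1 + E^d * g)\<close> outside
    \<open>1 + E^d * (S + g)\<close>, divided by \<open>E^(2*d)\<close>; the term
    \<open>R * g\<close> came with \<open>E^(3*d)\<close> and so keeps a factor
    \<open>c^d\<close>.\<close>
  define R' where "R' = R + S * g + mconst (c ^ d) * (R * g)"
  have "S * g \<in> polys_order_ge n (2 * d)"
    using polys_order_ge_mult[OF S g] by (simp add: mult_2)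
  then have "R' \<in> polys_order_ge n (2 * d)"
    unfolding R'_def by (intro polys_order_ge_add polys_order_ge_mconst_mult R Rg)
  moreover have "(\<Prod>i=1..Suc T. 1 + (E * f i) ^ d) =
      (1 + E ^ d * S + E ^ (2 * d) * R) * (1 + E ^ d * g)"
    using eq by (simp add: g_def power_mult_distrib)
  then have "(\<Prod>i=1..Suc T. 1 + (E * f i) ^ d) =
      1 + E ^ d * (S + g) + E ^ (2 * d) * R'"
    by (simp add: R'_def E_def[symmetric] mconst_power algebra_simps mult_2_right power_add)
  ultimately show ?case
    by (auto simp: E_def S_def g_def)
qed

subsection \<open>Affine forms and gates\<close>

lemma affine_form_mconst_mult: "affine_form n p \<Longrightarrow> affine_form n (mconst c * p)"
  using keys_mconst_mult[of c p] by (auto simp: affine_form_def polys_in_def)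

lemma affine_form_mconst: "affine_form n (mconst c)"
  by (auto simp: affine_form_def polys_in_def mconst_def mon_degree_def split: if_splits)

lemma affine_form_add: "affine_form n p \<Longrightarrow> affine_form n q \<Longrightarrow> affine_form n (p + q)"
  using keys_add[of p q] unfolding affine_form_def polys_in_def by blast

lemma affine_form_embed_C: "linear_form n p \<Longrightarrow> affine_form n (embed_C p)"
  unfolding embed_C_def linear_form_def affine_form_def polys_in_def homogeneous_def
  by (blast dest: keys_map_subset[THEN subsetD] intro: eq_refl)

text \<open>The first factor absorbs the scalar, which costs no additional factor; an empty gate
  would have nothing to absorb it.\<close>

lemma prod_list_scale_gate:
  assumes "g \<noteq> []" and "\<forall>L\<in>set g. affine_form n L"
  shows "\<exists>g'. length g' = length g \<and> (\<forall>L\<in>set g'. affine_form n L) \<and>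
           prod_list g' = mconst c * prod_list g"
proof (cases g)
  case (Cons L g0)
  with assms show ?thesis
    by (intro exI[of _ "(mconst c * L) # g0"]) (auto simp: affine_form_mconst_mult mult.assoc)
qed (use assms in simp)

section \<open>Splitting \<open>1 + y^d\<close> into affine factors\<close>

lemma map_poly_add_hom:
  assumes "f 0 = 0" and "\<And>x y. f (x + y) = f x + f y"
  shows "map_poly f (p + q) = map_poly f p + map_poly f q"
  by (rule poly_eqI) (simp add: coeff_map_poly assms)

text \<open>The polynomial splits over the algebraically closed field \<open>'k\<close>, and the
  homomorphism \<open>h\<close> carries the splitting to any commutative ring, where an arbitrary
  element may be substituted for the variable.\<close>

lemma one_plus_power_factorization:
  fixes h :: "'k::alg_closed_field \<Rightarrow> 'a::comm_ring_1"
  assumes d: "d \<ge> 1"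
    and h0: "h 0 = 0" and h1: "h 1 = 1"
    and hadd: "\<And>x y. h (x + y) = h x + h y" and hmult: "\<And>x y. h (x * y) = h x * h y"
  shows "\<exists>as. length as = d \<and> (\<forall>y. 1 + y ^ d = prod_list (map (\<lambda>a. 1 + h a * y) as))"
proof -
  define p :: "'k poly" where "p = monom 1 d + 1"
  have deg: "degree p = d"
    unfolding p_def using d by (subst degree_add_eq_left) (simp_all add: degree_monom_eq)
  then have lc: "lead_coeff p = 1"
    using d by (simp add: p_def)
  have "p \<noteq> 0" using deg d by auto
  then obtain A where A: "size A = d" "p = (\<Prod>x\<in>#A. [:-x, 1:])"
    using alg_closed_imp_factorization[of p] deg lc by auto
  obtain xs where xs: "mset xs = A" using ex_mset by blast
  define as where "as = map uminus xs"
  have refl_factor: "reflect_poly [:-x, 1:] = [:1, -x:]" for x :: 'k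
    by (cases "x = 0") (simp_all add: reflect_poly_def)
  have "p = prod_list (map (\<lambda>x. [:-x, 1:]) xs)"
    by (simp add: A(2) flip: xs mset_map prod_mset_prod_list)
  then have "reflect_poly p = prod_list (map (\<lambda>a. [:1, a:]) as)"
    by (simp add: reflect_poly_prod_list as_def o_def refl_factor)
  \<comment> \<open>The coefficients of \<open>1 + y^d\<close> are palindromic, so reversal keeps
    the product and turns the monic factors \<open>y - x\<close> into factors with constant term
    1.\<close>
  moreover have "reflect_poly p = p"
    using d by (intro poly_eqI) (auto simp: coeff_reflect_poly deg, auto simp: p_def)
  ultimately have p: "p = prod_list (map (\<lambda>a. [:1, a:]) as)" by simp
  \<comment> \<open>Multiplication by \<open>[:1, a:]\<close> unfolds into a sum with
    \<open>smult\<close> and \<open>pCons\<close>, and \<open>map_poly h\<close> respects each of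
    these.\<close>
  have eval: "poly (map_poly h (prod_list (map (\<lambda>a. [:1, a:]) as))) y =
      prod_list (map (\<lambda>a. 1 + h a * y) as)" for y and as :: "'k list"
    by (induction as)
       (simp_all add: h0 h1 hadd hmult map_poly_add_hom map_poly_smult map_poly_pCons algebra_simps)
  have "poly (map_poly h p) y = 1 + y ^ d" for y
    by (simp add: p_def map_poly_add_hom map_poly_monom h0 h1 hadd poly_monom)
  with p eval[of as] have "1 + y ^ d = prod_list (map (\<lambda>a. 1 + h a * y) as)" for y
    by metis
  moreover have "length as = d"
    using A(1) xs by (auto simp: as_def)
  ultimately show ?thesis by blast
qed

text \<open>Substituting the scaled linear form \<open>mconst c * embed_C (l i)\<close> for
  \<open>y\<close> in the splitting of \<open>1 + y^d\<close> gives \<open>d\<close> affine forms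
  for each \<open>i\<close>; the gate concatenates these lists.\<close>

lemma prod_one_plus_power_gate:
  fixes l :: "nat \<Rightarrow> complex mpoly"
  assumes "d \<ge> 1" and "\<And>i. i \<in> {1..T} \<Longrightarrow> linear_form n (l i)"
  shows "\<exists>g. length g = d * T \<and> (\<forall>L\<in>set g. affine_form n L) \<and>
           prod_list g = (\<Prod>i=1..T. 1 + (mconst c * embed_C (l i)) ^ d)"
proof -
  define h :: "complex \<Rightarrow> ratfun mpoly" where "h = (\<lambda>a. mconst (to_fract [:a:]))"
  have "h 0 = 0" "h 1 = 1" "h (x + y) = h x + h y" "h (x * y) = h x * h y" for x y
    by (simp_all add: h_def mconst_def one_pCons[symmetric] single_add[symmetric] mult_single
          mult.commute flip: to_fract_add to_fract_mult)
  from one_plus_power_factorization[OF assms(1), of h, OF this]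
  obtain as where as: "length as = d"
    "1 + y ^ d = prod_list (map (\<lambda>a. 1 + h a * y) as)" for y
    by blast
  show ?thesis using assms(2)
  proof (induction T)
    case 0
    show ?case by simp
  next
    case (Suc T)
    then obtain g where g: "length g = d * T" "\<forall>L\<in>set g. affine_form n L"
      "prod_list g = (\<Prod>i=1..T. 1 + (mconst c * embed_C (l i)) ^ d)"
      by auto
    define y where "y = mconst c * embed_C (l (Suc T))"
    have "affine_form n (1 + h a * y)" for a
      unfolding h_def y_def mconst_one[symmetric]
      by (intro affine_form_add affine_form_mconst affine_form_mconst_mult affine_form_embed_C
            Suc.prems) simp
    with g as show ?case
      by (intro exI[of _ "g @ map (\<lambda>a. 1 + h a * y) as"]) (auto simp: y_def)
  qed
qed

section \<open>Assembling the two-gate circuit\<close>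

theorem theorem1p4:
  fixes n d T :: nat
    and l :: "nat \<Rightarrow> complex mpoly"
    and P :: "complex mpoly"
  assumes "n \<ge> 1" and "d \<ge> 1" and "T \<ge> 1"
    and "\<And>i. i \<in> {1..T} \<Longrightarrow> linear_form n (l i)"
    and "P = (\<Sum>i=1..T. l i ^ d)"
  shows "\<exists>C :: ratfun circuit3.
           depth3_circuit n C \<and> top_fanin C \<le> d + 1 \<and> formal_degree C \<le> d * T \<and>
           (\<exists>Q :: complex poly mpoly.
              Q \<in> polys_in n \<and>
              (\<forall>m\<in>Poly_Mapping.keys Q. mon_degree m > d) \<and>
              computed_poly C = embed_C P + mconst eps * embed_Ceps Q)"
proof -
  define E :: "ratfun mpoly" where "E = mconst eps"
  \<comment> \<open>This scalar cancels the factor \<open>E^d\<close> in front of \<open>P\<close>;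
    negative powers of \<open>eps\<close> enter the circuit only here and in the constant
    gate.\<close>
  define F :: "ratfun mpoly" where "F = mconst (inverse eps ^ d)"
  define f :: "nat \<Rightarrow> complex poly mpoly" where "f = (\<lambda>i. Poly_Mapping.map (\<lambda>c. [:c:]) (l i))"
  define X :: "complex poly" where "X = [:0, 1:]"
  have emb_f: "embed_Ceps (f i) = embed_C (l i)" for i
    by (simp add: f_def embed_C_conv_embed_Ceps)
  have emb_X: "embed_Ceps (mconst X) = E"
    by (simp add: embed_Ceps_mconst E_def eps_def X_def)
  have FE: "F * E ^ d = 1"
    by (simp add: F_def E_def eps_def flip: mconst_power mconst_mult power_mult_distrib)

  have "f i \<in> polys_order_ge n 1" if "i \<in> {1..T}" for i
    using assms(4)[OF that] keys_map_subset[of "\<lambda>c. [:c:]" "l i"]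
    by (auto simp: f_def polys_order_ge_def linear_form_def polys_in_def homogeneous_def)
  from prod_one_plus_power_expansion[of T f n d X, OF this]
  obtain R where R: "R \<in> polys_order_ge n (2 * d)"
    and eq: "(\<Prod>i=1..T. 1 + (mconst X * f i) ^ d) =
      1 + mconst X ^ d * (\<Sum>i=1..T. f i ^ d) + mconst X ^ (2 * d) * R"
    by blast
  \<comment> \<open>The expansion over \<open>complex poly\<close> is transported to
    \<open>ratfun\<close>, where the gates live.\<close>
  have prod_eq: "(\<Prod>i=1..T. 1 + (E * embed_C (l i)) ^ d) =
      1 + E ^ d * embed_C P + E ^ (2 * d) * embed_Ceps R"
    using arg_cong[OF eq, of embed_Ceps]
    by (simp add: embed_Ceps_prod embed_Ceps_add embed_Ceps_one embed_Ceps_power embed_Ceps_mult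
          embed_Ceps_sum emb_f emb_X assms(5) embed_C_sum embed_C_power)

  obtain g0 where g0: "length g0 = d * T" "\<forall>L\<in>set g0. affine_form n L"
    "prod_list g0 = (\<Prod>i=1..T. 1 + (E * embed_C (l i)) ^ d)"
    unfolding E_def using prod_one_plus_power_gate[of d T n l eps] assms(2,4) by blast
  have "g0 \<noteq> []" using g0(1) assms(2,3) by auto
  then obtain g where g: "length g = d * T" "\<forall>L\<in>set g. affine_form n L"
    "prod_list g = F * prod_list g0"
    unfolding F_def using prod_list_scale_gate g0(1,2) by metis

  \<comment> \<open>The constant gate removes the contribution \<open>F * 1\<close> of the leading 1
    in the expansion.\<close>
  define C where "C = [g, [mconst (- (inverse eps ^ d))]]"
  \<comment> \<open>After scaling by \<open>F\<close> the remainder is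
    \<open>E^d * embed_Ceps R\<close>. One factor \<open>E\<close> is split off for the required
    \<open>eps * Q\<close>; as \<open>d \<ge> 1\<close>, the exponent \<open>d - 1\<close> is not
    truncated.\<close>
  define Q where "Q = mconst (X ^ (d - 1)) * R"
  have neg: "mconst (- (inverse eps ^ d)) = - F"
    by (simp add: F_def mconst_def single_uminus)
  have "computed_poly C = F * (1 + E ^ d * embed_C P + E ^ (2 * d) * embed_Ceps R) - F"
    by (simp add: computed_poly_def C_def neg g(3) g0(3) prod_eq[simplified])
  also have "\<dots> = (F * E ^ d) * (embed_C P + E ^ d * embed_Ceps R)"
    by (simp add: algebra_simps mult_2_right power_add)
  also have "\<dots> = embed_C P + E * embed_Ceps Q"
    unfolding FE using assms(2)
    by (simp add: Q_def embed_Ceps_mult mconst_power embed_Ceps_power emb_X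
          power_eq_if[of E d] mult.assoc)
  finally have "computed_poly C = embed_C P + mconst eps * embed_Ceps Q"
    by (simp add: E_def)
  moreover have "Q \<in> polys_order_ge n (2 * d)"
    unfolding Q_def by (intro polys_order_ge_mconst_mult R)
  \<comment> \<open>Order at least \<open>2 * d\<close> exceeds \<open>d\<close> strictly because
    \<open>d \<ge> 1\<close>.\<close>
  then have "Q \<in> polys_in n" "\<forall>m\<in>Poly_Mapping.keys Q. mon_degree m > d"
    using assms(2) by (force simp: polys_order_ge_def polys_in_def)+
  moreover have "depth3_circuit n C"
    using g(2) by (auto simp: depth3_circuit_def C_def affine_form_mconst)
  \<comment> \<open>There are two gates, of lengths \<open>d * T\<close> and 1;
    \<open>d \<ge> 1\<close> gives \<open>2 \<le> d + 1\<close>, and with \<open>T \<ge> 1\<close>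
    also \<open>1 \<le> d * T\<close>.\<close>
  moreover have "top_fanin C \<le> d + 1" "formal_degree C \<le> d * T"
    using assms(2,3) g(1) by (simp_all add: top_fanin_def formal_degree_def C_def)
  ultimately show ?thesis by blast
qed

end
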